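(* Let $G=\mathbb{Z}_{n_1}\times\cdots\times\mathbb{Z}_{n_d}$, where $n_1,\ldots,n_d\ge 2$, let $n=n_1\cdots n_d$, and let $S$ be an inverse-closed subset of $G\setminus\{(0,\ldots,0)\}$ with $\langle S\rangle=G$. Let $S_0=S\cup\{(0,\ldots,0)\}$. Suppose that $|S_0|=p^l$ is a prime power ($p$ prime) such that $p^l\mid n$ but $p^{l+1}\nmid n$. Suppose further that exactly one of $n_1,\ldots,n_d$, say $n_t$, is divisible by $p$. Then $\mathrm{Cay}(G,S)$ admits a perfect code if and only if $s_t\not\equiv s'_t\pmod{p^l}$ for each pair of distinct elements $(s_1,\ldots,s_d),(s'_1,\ldots,s'_d)$ of $S_0$.
   Context: Inverse-closed means $-S=S$. The Cayley graph $\mathrm{Cay}(G,S)$ has vertex set $G$, with $x,y$ adjacent iff $y-x\in S$. A perfect code in a graph is a set $C$ of vertices such that no two vertices in $C$ are adjacent and every vertex outside $C$ is adjacent to exactly one vertex of $C$. Congruence of elements of $\mathbb{Z}_{n_t}$ modulo $p^l$ makes sense since $p^l\mid n_t$. *)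

theory Defs
  imports
    "HOL-Algebra.Product_Groups"
    "HOL-Algebra.Generated_Groups"
    "HOL-Number_Theory.Cong"
    "Graph_Theory.Pair_Digraph"
begin

text \<open>
  The group \<open>\<int>\<^sub>n\<close> is \<open>integer_mod_group n\<close>, with carrier \<open>{0..<int n}\<close> for \<open>n > 0\<close>.
  Groups are written multiplicatively in HOL-Algebra: the zero tuple is \<open>\<one>\<close>,
  \<open>- S\<close> is \<open>set_inv S\<close>, and \<open>y - x\<close> is \<open>y \<otimes> inv x\<close>.
\<close>

definition cyclic_product :: "nat \<Rightarrow> (nat \<Rightarrow> nat) \<Rightarrow> (nat \<Rightarrow> int) monoid" where
  "cyclic_product d ns = product_group {1..d} (\<lambda>i. integer_mod_group (ns i))"

text \<open>
  An undirected edge is represented by its two arcs. For an inverse-closed \<open>S\<close> not containing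
  the identity of a finite group, the result is a simple graph (locale \<open>pair_graph\<close>), as shown
  below.
\<close>

definition cayley_graph :: "('a, 'b) monoid_scheme \<Rightarrow> 'a set \<Rightarrow> 'a pair_pre_digraph" where
  "cayley_graph G S =
     \<lparr> pverts = carrier G,
       parcs = {(x, y). x \<in> carrier G \<and> y \<in> carrier G \<and> y \<otimes>\<^bsub>G\<^esub> inv\<^bsub>G\<^esub> x \<in> S} \<rparr>"

definition perfect_code :: "'a pair_pre_digraph \<Rightarrow> 'a set \<Rightarrow> bool" where
  "perfect_code \<Gamma> C \<longleftrightarrow>
     C \<subseteq> pverts \<Gamma> \<and>
     (\<forall>x\<in>C. \<forall>y\<in>C. (x, y) \<notin> parcs \<Gamma>) \<and>
     (\<forall>x\<in>pverts \<Gamma> - C. \<exists>!c. c \<in> C \<and> (x, c) \<in> parcs \<Gamma>)"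

lemma (in group) pair_graph_cayley_graph:
  assumes "finite (carrier G)" and "\<one> \<notin> S" and "set_inv S = S"
  shows "pair_graph (cayley_graph G S)"
proof
  let ?A = "parcs (cayley_graph G S)"
  have sub: "?A \<subseteq> carrier G \<times> carrier G"
    by (auto simp: cayley_graph_def)
  then show "finite ?A"
    using assms(1) finite_subset by blast
  show "finite (pverts (cayley_graph G S))"
    using assms(1) by (simp add: cayley_graph_def)
  show "fst e \<in> pverts (cayley_graph G S)" "snd e \<in> pverts (cayley_graph G S)"
    if "e \<in> ?A" for e
    using that by (auto simp: cayley_graph_def)
  show "fst e \<noteq> snd e" if "e \<in> ?A" for e
    using that assms(2) by (auto simp: cayley_graph_def)
  have "x \<otimes> inv y \<in> S" if "x \<in> carrier G" "y \<in> carrier G" "y \<otimes> inv x \<in> S" for x y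
  proof -
    have "inv (y \<otimes> inv x) \<in> S"
      using that(3) assms(3) unfolding SET_INV_def by blast
    then show ?thesis
      using that by (simp add: inv_mult_group)
  qed
  then show "symmetric (with_proj (cayley_graph G S))"
    by (auto simp: symmetric_def sym_def cayley_graph_def)
qed

end

theory Submission
  imports Defs "HOL-Algebra.Multiplicative_Group"
begin

text \<open>
  In additive notation: for inverse-closed \<open>S\<close>, a perfect code in the Cayley graph is a set \<open>C\<close> such that
  every element of \<open>G\<close> is uniquely \<open>s + c\<close> with \<open>s \<in> S\<^sub>0\<close> and \<open>c \<in> C\<close>, that is,
  a complement of \<open>S\<^sub>0\<close> in a factorization of \<open>G\<close>
  (\<open>perfect_code_cayley_graph_iff\<close>).

  If \<open>C\<close> is such a complement, then \<open>|C| = n / p\<^sup>l\<close> is prime to \<open>p\<close>.  In this situation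
  \<open>C\<close> may be replaced by \<open>p C\<close>, the set of all \<open>p c\<close>
  (\<open>factorization_prime_power_image\<close>): this is where arithmetic enters, by way of the
  Frobenius map of the group ring modulo \<open>p\<close>.  After \<open>l\<close> replacements, the complement
  \<open>p\<^sup>l C\<close> lies in the kernel of every homomorphism to a group of order \<open>p\<^sup>l\<close>, in
  particular of \<open>x \<mapsto> x\<^sub>t mod p\<^sup>l\<close>.  Since \<open>S\<^sub>0\<close> and \<open>p\<^sup>l C\<close> together give all
  of \<open>G\<close>, this homomorphism already takes all its \<open>p\<^sup>l\<close> values on \<open>S\<^sub>0\<close>, and by counting
  it takes them once each.  Conversely, if it is injective on \<open>S\<^sub>0\<close>, then \<open>S\<^sub>0\<close> is a
  transversal of its kernel, and the kernel is a perfect code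
  (\<open>factorization_iff_inj_on_hom\<close>).

  Since \<open>p\<close> divides no other modulus, the full power \<open>p\<^sup>l\<close> of \<open>p\<close> in \<open>n\<close> divides
  \<open>n\<^sub>t\<close>, so that reduction of the component \<open>x\<^sub>t\<close> modulo \<open>p\<^sup>l\<close> is a homomorphism.
\<close>

section \<open>Fixed points of a map of prime order\<close>

lemma card_funpow_orbit_prime:
  assumes p: "prime p" and fp: "(f ^^ p) x = x" and fx: "f x \<noteq> x"
  shows "card (range (\<lambda>k. (f ^^ k) x)) = p"
proof -
  have p0: "p > 0" using p prime_gt_0_nat by blast
  have range_eq: "range (\<lambda>k. (f ^^ k) x) = (\<lambda>k. (f ^^ k) x) ` {..<p}"
    using funpow_mod_eq[OF fp] p0 by (auto simp: image_iff) (metis mod_less_divisor lessThan_iff)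
  have neq: "(f ^^ i) x \<noteq> (f ^^ j) x" if "i < j" "j < p" for i j
  proof
    assume eq: "(f ^^ i) x = (f ^^ j) x"
    define e where "e = j - i"
    have "(f ^^ (p - i + i)) x = (f ^^ (p - i + j)) x"
      unfolding funpow_add by (simp add: eq)
    moreover have "p - i + j = e + p" using that by (simp add: e_def)
    ultimately have e_fix: "(f ^^ e) x = x"
      using that fp by (simp add: funpow_add)
    \<comment> \<open>So both \<open>f ^^ e\<close> and \<open>f ^^ p\<close> fix \<open>x\<close>; as \<open>e\<close> and \<open>p\<close> are coprime, so does \<open>f\<close>.\<close>
    have "coprime e p" "e \<noteq> 0"
      using that p
      by (auto simp: e_def coprime_commute prime_nat_iff dest: dvd_imp_le intro!: prime_imp_coprime)
    then obtain u v where uv: "e * u = p * v + 1"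
      using bezout_nat[of e p] by auto
    have "(f ^^ (e * u)) x = x"
      using funpow_mod_eq[OF e_fix, of "e * u"] by simp
    moreover have "(f ^^ (p * v)) x = x"
      using funpow_mod_eq[OF fp, of "p * v"] by simp
    ultimately show False
      using uv fx by simp
  qed
  have "inj_on (\<lambda>k. (f ^^ k) x) {..<p}"
    by (rule inj_onI) (metis neq lessThan_iff linorder_neqE_nat)
  then show ?thesis
    by (simp add: range_eq card_image)
qed

text \<open>
  The points that are not fixed split into orbits of length exactly \<open>p\<close>.
\<close>

lemma card_cong_card_fixed_points:
  assumes fin: "finite X" and p: "prime p"
    and maps: "\<And>x. x \<in> X \<Longrightarrow> f x \<in> X" and fp: "\<And>x. x \<in> X \<Longrightarrow> (f ^^ p) x = x"
  shows "[card X = card {x \<in> X. f x = x}] (mod p)"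
proof -
  define Y where "Y = {x \<in> X. f x \<noteq> x}"
  define orb where "orb x = range (\<lambda>k. (f ^^ k) x)" for x
  have p0: "p > 0" using p prime_gt_0_nat by blast
  \<comment> \<open>A fixed point \<open>f x\<close> would stay fixed, but \<open>p - 1\<close> further steps lead from it back to \<open>x\<close>.\<close>
  have mapsY: "f x \<in> Y" if "x \<in> Y" for x
  proof -
    have "f (f x) \<noteq> f x"
    proof
      assume "f (f x) = f x"
      then have "(f ^^ k) (f x) = f x" for k
        by (induction k) auto
      moreover have "(f ^^ (p - 1)) (f x) = x"
        using fp[of x] that p0
        by (metis (no_types, lifting) Suc_pred' Y_def comp_apply funpow_Suc_right mem_Collect_eq
            diff_Suc_eq_diff_pred minus_nat.diff_0)
      ultimately show False
        using that by (simp add: Y_def)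
    qed
    then show ?thesis using that maps by (simp add: Y_def)
  qed
  have pow_in_Y: "(f ^^ k) x \<in> Y" if "x \<in> Y" for x k
    by (induction k) (use that mapsY in auto)
  have orbit_shift: "orb ((f ^^ k) x) = orb x" if "x \<in> Y" for x k
  proof
    show "orb ((f ^^ k) x) \<subseteq> orb x"
      by (auto simp: orb_def simp flip: funpow_add comp_apply[of "f ^^ _" "f ^^ _"])
    have "(f ^^ m) x \<in> orb ((f ^^ k) x)" for m
    proof -
      have fx: "(f ^^ p) x = x" using that fp by (simp add: Y_def)
      \<comment> \<open>Going back by \<open>k\<close> steps amounts to \<open>(p - 1) * k\<close> steps forward.\<close>
      have "(f ^^ (m + (p - 1) * k)) ((f ^^ k) x) = (f ^^ (m + p * k)) x"
      proof -
        have "m + (p - 1) * k + k = m + p * k"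
          using p0 by (cases p) auto
        then show ?thesis
          by (metis comp_apply funpow_add)
      qed
      also have "\<dots> = (f ^^ m) x"
        using funpow_mod_eq[OF fx, of "m + p * k"] funpow_mod_eq[OF fx, of m] by simp
      finally show ?thesis
        unfolding orb_def by (metis rangeI)
    qed
    then show "orb x \<subseteq> orb ((f ^^ k) x)"
      by (auto simp: orb_def)
  qed
  have Un: "\<Union> (orb ` Y) = Y"
  proof -
    have "x \<in> orb x" for x
      unfolding orb_def by (rule range_eqI[of _ _ 0]) simp
    then show ?thesis
      using pow_in_Y by (auto simp: orb_def)
  qed
  have "p dvd card (\<Union> (orb ` Y))"
  proof (rule dvd_partition)
    show "finite (\<Union> (orb ` Y))"
      unfolding Un using fin by (simp add: Y_def)
    show "\<forall>c\<in>orb ` Y. p dvd card c"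
    proof
      fix c assume "c \<in> orb ` Y"
      then obtain x where "x \<in> X" "f x \<noteq> x" "c = orb x"
        by (auto simp: Y_def)
      then show "p dvd card c"
        using card_funpow_orbit_prime[OF p fp] by (simp add: orb_def)
    qed
    have "orb x = orb y" if "x \<in> Y" "y \<in> Y" "orb x \<inter> orb y \<noteq> {}" for x y
    proof -
      obtain i j where "(f ^^ i) x = (f ^^ j) y"
        using \<open>orb x \<inter> orb y \<noteq> {}\<close> by (auto simp: orb_def)
      then show ?thesis
        using orbit_shift that by metis
    qed
    then show "\<forall>c1\<in>orb ` Y. \<forall>c2\<in>orb ` Y. c1 \<noteq> c2 \<longrightarrow> c1 \<inter> c2 = {}"
      by blast
  qed
  moreover have "card X = card {x \<in> X. f x = x} + card Y"
    using fin unfolding Y_def by (subst card_Un_disjoint[symmetric]) (auto intro: arg_cong[of _ _ card])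
  ultimately show ?thesis
    by (simp add: Un cong_def mod_add_eq dvd_eq_mod_eq_0 flip: mod_add_right_eq)
qed


section \<open>Factorizations of a finite abelian group\<close>

definition (in monoid) factorization :: "'a set \<Rightarrow> 'a set \<Rightarrow> bool" where
  "factorization A B \<longleftrightarrow> A \<subseteq> carrier G \<and> B \<subseteq> carrier G \<and>
     bij_betw (\<lambda>(a, b). a \<otimes> b) (A \<times> B) (carrier G)"

lemma (in monoid) factorization_surj:
  assumes "factorization A B" "g \<in> carrier G"
  obtains a b where "a \<in> A" "b \<in> B" "a \<otimes> b = g"
proof -
  have "g \<in> (\<lambda>(a, b). a \<otimes> b) ` (A \<times> B)"
    using assms unfolding factorization_def bij_betw_def by simp
  then show ?thesis
    using that by auto
qed

lemma (in monoid) factorization_inj: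
  assumes "factorization A B" "a \<in> A" "b \<in> B" "a' \<in> A" "b' \<in> B" "a \<otimes> b = a' \<otimes> b'"
  shows "a = a' \<and> b = b'"
  using assms unfolding factorization_def bij_betw_def inj_on_def by auto

lemma (in monoid) card_factorization:
  assumes "factorization A B"
  shows "card A * card B = card (carrier G)"
  using assms bij_betw_same_card[of _ "A \<times> B"]
  unfolding factorization_def by (metis card_cartesian_product)

lemma (in monoid) foldr_mult_closed:
  assumes "set xs \<subseteq> carrier G"
  shows "foldr (\<otimes>) xs \<one> \<in> carrier G"
  using assms by (induction xs) auto

lemma (in comm_monoid) foldr_mult_rotate1:
  assumes "set xs \<subseteq> carrier G"
  shows "foldr (\<otimes>) (rotate1 xs) \<one> = foldr (\<otimes>) xs \<one>"
proof -
  have "foldr (\<otimes>) (ys @ [x]) \<one> = x \<otimes> foldr (\<otimes>) ys \<one>"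
    if "set ys \<subseteq> carrier G" "x \<in> carrier G" for x ys
    using that
  proof (induction ys)
    case (Cons y ys)
    then have "y \<in> carrier G" "foldr (\<otimes>) ys \<one> \<in> carrier G"
      using foldr_mult_closed by auto
    then show ?case
      using Cons m_lcomm[of y x "foldr (\<otimes>) ys \<one>"] by simp
  qed simp
  then show ?thesis
    using assms by (cases xs) (simp_all del: foldr_append)
qed

text \<open>
  All entries but the first are free: once they are chosen, the factorization determines both
  the first entry and the factor in \<open>A\<close>.  In the group ring, this count is the coefficient of
  \<open>g\<close> in \<open>A \<cdot> B\<^bsup>k+1\<^esup> = |B|\<^sup>k G\<close>.
\<close>

lemma (in comm_group) card_lists_product_factorization:
  assumes fact: "factorization A B" and fin: "finite B" and g: "g \<in> carrier G"
  shows "card {bs. length bs = Suc k \<and> set bs \<subseteq> B \<and> (\<exists>a\<in>A. a \<otimes> foldr (\<otimes>) bs \<one> = g)} = card B ^ k"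
    (is "card ?X = _")
proof -
  have AB: "A \<subseteq> carrier G" "B \<subseteq> carrier G"
    using fact by (auto simp: factorization_def)
  let ?Y = "{bs. set bs \<subseteq> B \<and> length bs = k}"
  have "bij_betw tl ?X ?Y"
  proof (rule bij_betw_imageI)
    show "inj_on tl ?X"
    proof (rule inj_onI)
      fix xs ys assume xs: "xs \<in> ?X" and ys: "ys \<in> ?X" and tl: "tl xs = tl ys"
      obtain x y bs where eqs: "xs = x # bs" "ys = y # bs"
        using xs ys tl by (cases xs; cases ys) auto
      obtain a a' where a: "a \<in> A" "a' \<in> A"
        "a \<otimes> (x \<otimes> foldr (\<otimes>) bs \<one>) = g" "a' \<otimes> (y \<otimes> foldr (\<otimes>) bs \<one>) = g"
        using xs ys eqs by auto
      have inB: "x \<in> B" "y \<in> B" "set bs \<subseteq> B"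
        using xs ys eqs by auto
      have carr: "foldr (\<otimes>) bs \<one> \<in> carrier G" "x \<in> carrier G" "y \<in> carrier G"
        "a \<in> carrier G" "a' \<in> carrier G"
        using inB a AB by (auto intro!: foldr_mult_closed)
      have "(a \<otimes> x) \<otimes> foldr (\<otimes>) bs \<one> = (a' \<otimes> y) \<otimes> foldr (\<otimes>) bs \<one>"
        using a carr by (simp add: m_assoc)
      then have "a \<otimes> x = a' \<otimes> y"
        using carr by simp
      then show "xs = ys"
        using factorization_inj[OF fact] a inB eqs by blast
    qed
    have "bs \<in> tl ` ?X" if bs: "bs \<in> ?Y" for bs
    proof -
      let ?q = "foldr (\<otimes>) bs \<one>"
      have q: "?q \<in> carrier G"
        using bs AB by (auto intro!: foldr_mult_closed)
      obtain a b where ab: "a \<in> A" "b \<in> B" "a \<otimes> b = g \<otimes> inv ?q"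
        using factorization_surj[OF fact, of "g \<otimes> inv ?q"] q g by auto
      have "a \<otimes> (b \<otimes> ?q) = g"
      proof -
        have "a \<otimes> (b \<otimes> ?q) = (a \<otimes> b) \<otimes> ?q"
          using ab(1,2) AB q by (simp add: m_assoc subset_iff)
        also have "\<dots> = g"
          using ab q g by (simp add: m_assoc)
        finally show ?thesis .
      qed
      then have "b # bs \<in> ?X"
        using ab bs by auto
      then show ?thesis
        by (intro image_eqI[of _ _ "b # bs"]) simp_all
    qed
    moreover have "tl bs \<in> ?Y" if "bs \<in> ?X" for bs
      using that by (cases bs) auto
    ultimately show "tl ` ?X = ?Y"
      by blast
  qed
  then have "card ?X = card ?Y"
    by (rule bij_betw_same_card)
  then show ?thesis
    by (simp add: card_lists_length_eq fin)
qed

lemma (in comm_monoid) foldr_mult_replicate: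
  assumes "x \<in> carrier G"
  shows "foldr (\<otimes>) (replicate k x) \<one> = x [^] k"
  by (induction k) (use assms in \<open>auto simp: m_comm\<close>)

text \<open>
  In the group ring modulo \<open>p\<close>, the factorization gives
  \<open>A \<cdot> B\<^sup>p = |B|\<^bsup>p-1\<^esup> G\<close>, and by Frobenius \<open>B\<^sup>p\<close> is the sum of the \<open>p\<close>-th powers
  of the elements of \<open>B\<close>.  Since \<open>|B|\<close> is prime to \<open>p\<close>, every element of the group is
  therefore a product of an element of \<open>A\<close> and such a \<open>p\<close>-th power; a comparison of
  cardinalities shows that it is so in one way only.

  The congruence of coefficients at \<open>g\<close> is obtained by counting: rotation acts on the lists of
  \<open>p\<close> elements of \<open>B\<close> whose product lies in \<open>g \<cdot> A\<^bsup>-1\<^esup>\<close>, and a list fixed by rotation is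
  constant, with product \<open>b\<^sup>p\<close>.
\<close>

lemma (in comm_group) factorization_prime_power_image:
  assumes fin: "finite (carrier G)" and fact: "factorization A B"
    and p: "prime p" and ndvd: "\<not> p dvd card B"
  shows "factorization A ((\<lambda>b. b [^] p) ` B)" "card ((\<lambda>b. b [^] p) ` B) = card B"
proof -
  let ?B = "(\<lambda>b. b [^] p) ` B"
  have AB: "A \<subseteq> carrier G" "B \<subseteq> carrier G"
    using fact by (auto simp: factorization_def)
  have finA: "finite A" and finB: "finite B"
    using AB fin finite_subset by blast+
  have sub: "?B \<subseteq> carrier G"
    using AB by auto
  have surj: "\<exists>a\<in>A. \<exists>b\<in>B. a \<otimes> b [^] p = g" if g: "g \<in> carrier G" for g
  proof -
    define X where "X = {bs. length bs = p \<and> set bs \<subseteq> B \<and> (\<exists>a\<in>A. a \<otimes> foldr (\<otimes>) bs \<one> = g)}"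
    have "finite X"
      by (rule finite_subset[OF _ finite_lists_length_eq[OF finB, of p]]) (auto simp: X_def)
    have "[card X = card {bs \<in> X. rotate1 bs = bs}] (mod p)"
    proof (rule card_cong_card_fixed_points[OF \<open>finite X\<close> p])
      fix bs assume bs: "bs \<in> X"
      have "foldr (\<otimes>) (rotate1 bs) \<one> = foldr (\<otimes>) bs \<one>"
        using bs AB by (intro foldr_mult_rotate1) (auto simp: X_def)
      then show "rotate1 bs \<in> X"
        using bs by (simp add: X_def)
      show "(rotate1 ^^ p) bs = bs"
        using bs rotate_id[of p bs] by (simp add: X_def rotate_def)
    qed
    moreover have "card X = card B ^ (p - 1)"
      using card_lists_product_factorization[OF fact finB g, of "p - 1"] prime_gt_0_nat[OF p]
      by (simp add: X_def)
    moreover have "\<not> p dvd card B ^ (p - 1)"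
      using p ndvd prime_dvd_power by blast
    ultimately have "\<not> p dvd card {bs \<in> X. rotate1 bs = bs}"
      using cong_dvd_iff by metis
    then have "{bs \<in> X. rotate1 bs = bs} \<noteq> {}"
      by (metis card.empty dvd_0_right)
    then obtain bs where bs: "bs \<in> X" "rotate1 bs = bs"
      by blast
    have "bs \<noteq> []"
      using bs prime_gt_0_nat[OF p] by (auto simp: X_def)
    then obtain b where "set bs = {b}"
      using rotate1_fixpoint_card[OF bs(2)] card_1_singletonE by blast
    then have b: "bs = replicate p b" "b \<in> B"
      using bs replicate_eqI[of bs p b] by (auto simp: X_def)
    then have "foldr (\<otimes>) bs \<one> = b [^] p"
      using AB foldr_mult_replicate[of b p] by auto
    then show ?thesis
      using bs(1) b(2) by (auto simp: X_def)
  qed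
  let ?f = "\<lambda>(a, b). a \<otimes> b"
  have img: "?f ` (A \<times> ?B) = carrier G"
  proof
    show "?f ` (A \<times> ?B) \<subseteq> carrier G"
      using AB by (auto simp: subset_iff)
    show "carrier G \<subseteq> ?f ` (A \<times> ?B)"
    proof
      fix g assume "g \<in> carrier G"
      then obtain a b where "a \<in> A" "b \<in> B" "a \<otimes> b [^] p = g"
        using surj by blast
      then show "g \<in> ?f ` (A \<times> ?B)"
        by (intro image_eqI[of _ _ "(a, b [^] p)"]) auto
    qed
  qed
  have "card A * card B = card (carrier G)"
    by (rule card_factorization[OF fact])
  also have "\<dots> \<le> card (A \<times> ?B)"
    using card_image_le[of "A \<times> ?B" ?f] finA finB by (simp only: img) simp
  finally have le: "card A * card B \<le> card A * card ?B"
    by (simp add: card_cartesian_product)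
  have "A \<noteq> {}"
    using surj[OF one_closed] by blast
  then have "card A > 0"
    using finA by auto
  then show eq: "card ?B = card B"
    using le card_image_le[OF finB, of "\<lambda>b. b [^] p"] by auto
  have "inj_on ?f (A \<times> ?B)"
    using finA finB card_factorization[OF fact] img
    by (intro eq_card_imp_inj_on) (simp_all add: card_cartesian_product eq)
  then show "factorization A ?B"
    unfolding factorization_def using AB(1) sub img by (intro conjI bij_betw_imageI)
qed

lemma (in comm_group) factorization_iterated_prime_power_image:
  assumes "finite (carrier G)" "factorization A B" "prime p" "\<not> p dvd card B"
  shows "factorization A ((\<lambda>b. b [^] (p ^ l)) ` B) \<and> card ((\<lambda>b. b [^] (p ^ l)) ` B) = card B"
proof (induction l)
  case 0
  have "(\<lambda>b. b [^] (p ^ 0)) ` B = B"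
    using assms(2) by (force simp: factorization_def image_iff)
  then show ?case
    using assms(2) by simp
next
  case (Suc l)
  have "(\<lambda>b. b [^] p) ` (\<lambda>b. b [^] (p ^ l)) ` B = (\<lambda>b. b [^] (p ^ Suc l)) ` B"
    using assms(2) unfolding image_image
    by (intro image_cong) (auto simp: factorization_def nat_pow_pow mult.commute)
  then show ?case
    using factorization_prime_power_image[OF assms(1) _ assms(3), of A "(\<lambda>b. b [^] (p ^ l)) ` B"] Suc assms(4)
    by simp
qed

text \<open>
  If \<open>B\<close> is a complement of \<open>A\<close>, so is the set of its \<open>p\<^sup>l\<close>-th powers, because \<open>|B|\<close> is
  prime to \<open>p\<close>.  These powers lie in the kernel of \<open>h\<close>, so that \<open>h\<close> maps \<open>A\<close> alone onto
  \<open>H\<close>, and injectivity follows by counting.  Conversely, if \<open>h\<close> is injective on \<open>A\<close>, then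
  \<open>A\<close> is a transversal of the kernel, which is therefore a complement.
\<close>

theorem (in comm_group) factorization_iff_inj_on_hom:
  assumes fin: "finite (carrier G)" and A: "A \<subseteq> carrier G"
    and H: "group H" and h: "h \<in> hom G H" and surj: "h ` carrier G = carrier H"
    and p: "prime p" and cardH: "card (carrier H) = p ^ l" and cardA: "card A = p ^ l"
    and ndvd: "\<not> p ^ (l + 1) dvd card (carrier G)"
  shows "(\<exists>B. factorization A B) \<longleftrightarrow> inj_on h A"
proof
  interpret H: group H by fact
  interpret h: group_hom G H h
    by unfold_locales (rule h)
  have finA: "finite A"
    using A fin finite_subset by blast
  have finH: "finite (carrier H)"
    using surj fin by (metis finite_imageI)
  {
    assume "\<exists>B. factorization A B"
    then obtain B where B: "factorization A B" ..
    let ?B = "(\<lambda>b. b [^] (p ^ l)) ` B"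
    have "p ^ l * card B = card (carrier G)"
      using card_factorization[OF B] cardA by simp
    then have "\<not> p dvd card B"
      using ndvd by (metis mult_dvd_mono dvd_refl power_add power_one_right)
    then have B': "factorization A ?B"
      using factorization_iterated_prime_power_image[OF fin B p] by blast
    have ker: "h b = \<one>\<^bsub>H\<^esub>" if b: "b \<in> ?B" for b
    proof -
      obtain c where "c \<in> carrier G" "b = c [^] (p ^ l)"
        using b B by (auto simp: factorization_def)
      then show ?thesis
        using H.pow_order_eq_1[of "h c"] cardH
        by (simp add: h.hom_nat_pow order_def)
    qed
    have "carrier H \<subseteq> h ` A"
    proof
      fix y assume "y \<in> carrier H"
      then obtain g where g: "g \<in> carrier G" "y = h g"
        using surj by auto
      obtain a b where ab: "a \<in> A" "b \<in> ?B" "a \<otimes> b = g"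
        using factorization_surj[OF B' g(1)] by blast
      have "a \<in> carrier G" "b \<in> carrier G"
        using ab B' by (auto simp: factorization_def)
      then have "y = h a"
        using ab g ker by (metis h.hom_mult h.hom_closed H.r_one)
      then show "y \<in> h ` A"
        using ab by blast
    qed
    then have "card (h ` A) = card A"
      using card_mono[of "h ` A" "carrier H"] card_image_le[OF finA, of h] finA cardH cardA by simp
    then show "inj_on h A"
      by (rule eq_card_imp_inj_on[OF finA])
  next
    assume inj: "inj_on h A"
    have hA: "h ` A = carrier H"
      by (rule card_subset_eq[OF finH]) (use A cardA cardH card_image[OF inj] in auto)
    let ?K = "kernel G H h"
    have "factorization A ?K"
      unfolding factorization_def
    proof (intro conjI bij_betw_imageI)
      show "?K \<subseteq> carrier G"
        by (auto simp: kernel_def)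
      show "inj_on (\<lambda>(a, b). a \<otimes> b) (A \<times> ?K)"
      proof (rule inj_onI, clarify)
        fix a b a' b'
        assume *: "a \<in> A" "a' \<in> A" "b \<in> ?K" "b' \<in> ?K" "a \<otimes> b = a' \<otimes> b'"
        then have carr: "a \<in> carrier G" "a' \<in> carrier G" "b \<in> carrier G" "b' \<in> carrier G"
          using A by (auto simp: kernel_def)
        have "h (a \<otimes> b) = h a" "h (a' \<otimes> b') = h a'"
          using *(3,4) carr by (auto simp: kernel_def)
        then have "a = a'"
          using *(1,2,5) inj by (metis inj_onD)
        then show "a = a' \<and> b = b'"
          using * carr by simp
      qed
      have "g \<in> (\<lambda>(a, b). a \<otimes> b) ` (A \<times> ?K)" if g: "g \<in> carrier G" for g
      proof -
        obtain a where a: "a \<in> A" "h a = h g"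
          using hA g h.hom_closed by (metis imageE)
        have carr: "a \<in> carrier G" using a A by auto
        have "inv a \<otimes> g \<in> ?K"
          using a g carr by (simp add: kernel_def h.hom_inv)
        moreover have "a \<otimes> (inv a \<otimes> g) = g"
          using g carr by (simp flip: m_assoc)
        ultimately show ?thesis
          using a by (intro image_eqI[of _ _ "(a, inv a \<otimes> g)"]) auto
      qed
      then show "(\<lambda>(a, b). a \<otimes> b) ` (A \<times> ?K) = carrier G"
        using A by (auto simp: kernel_def subset_iff)
    qed (rule A)
    then show "\<exists>B. factorization A B" ..
  }
qed


section \<open>Perfect codes in Cayley graphs\<close>

text \<open>
  In a perfect code \<open>C\<close>, the vertex dominating \<open>x\<close> is \<open>x\<close> itself or its
  unique neighbour in \<open>C\<close>; in both cases it is the unique \<open>c \<in> C\<close> for which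
  \<open>c - x\<close>, and hence \<open>x - c\<close>, lies in \<open>S \<union> {0}\<close> (in additive notation).
\<close>

lemma (in comm_group) perfect_code_cayley_graph_iff:
  assumes S: "S \<subseteq> carrier G - {\<one>}" and invS: "set_inv S = S"
  shows "perfect_code (cayley_graph G S) C \<longleftrightarrow> factorization (S \<union> {\<one>}) C"
proof -
  have S0: "S \<union> {\<one>} \<subseteq> carrier G" using S by auto
  have inv_S: "inv s \<in> S" if "s \<in> S" for s
    using that invS unfolding SET_INV_def by blast
  have diff_S: "c \<otimes> inv x \<in> S \<longleftrightarrow> x \<otimes> inv c \<in> S" if "x \<in> carrier G" "c \<in> carrier G" for x c
    using inv_S[of "c \<otimes> inv x"] inv_S[of "x \<otimes> inv c"] that by (auto simp: inv_mult_group)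
  have diff_one: "x \<otimes> inv c = \<one> \<longleftrightarrow> x = c" if "x \<in> carrier G" "c \<in> carrier G" for x c
    using that by (metis inv_closed inv_equality inv_inv r_inv)
  show ?thesis
  proof
    assume pc: "perfect_code (cayley_graph G S) C"
    have C: "C \<subseteq> carrier G"
      using pc by (simp add: perfect_code_def cayley_graph_def)
    have indep: "y \<otimes> inv x \<notin> S" if "x \<in> C" "y \<in> C" for x y
    proof -
      have "(x, y) \<notin> parcs (cayley_graph G S)" "x \<in> carrier G" "y \<in> carrier G"
        using pc that C by (auto simp: perfect_code_def)
      then show ?thesis
        by (simp add: cayley_graph_def)
    qed
    have dom: "\<exists>!c. c \<in> C \<and> c \<otimes> inv x \<in> S" if "x \<in> carrier G" "x \<notin> C" for x
    proof -
      have "\<exists>!c. c \<in> C \<and> (x, c) \<in> parcs (cayley_graph G S)"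
        using pc that by (simp add: perfect_code_def cayley_graph_def)
      then show ?thesis
        using that C by (auto simp: cayley_graph_def)
    qed
    have dom0: "\<exists>!c. c \<in> C \<and> x \<otimes> inv c \<in> S \<union> {\<one>}" if x: "x \<in> carrier G" for x
    proof (cases "x \<in> C")
      case True
      then have "c \<in> C \<and> x \<otimes> inv c \<in> S \<union> {\<one>} \<longleftrightarrow> c = x" for c
        using indep[of c x] C diff_one[OF x, of c] x by auto
      then show ?thesis
        by simp
    next
      case False
      then have "c \<in> C \<and> x \<otimes> inv c \<in> S \<union> {\<one>} \<longleftrightarrow> c \<in> C \<and> c \<otimes> inv x \<in> S" for c
        using x C diff_S diff_one by auto
      then show ?thesis
        using dom[OF x False] by simp
    qed
    show "factorization (S \<union> {\<one>}) C"
      unfolding factorization_def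
    proof (intro conjI S0 C bij_betw_imageI)
      show "inj_on (\<lambda>(a, b). a \<otimes> b) ((S \<union> {\<one>}) \<times> C)"
      proof (rule inj_onI, clarify)
        fix a b a' b'
        assume *: "a \<in> S \<union> {\<one>}" "a' \<in> S \<union> {\<one>}" "b \<in> C" "b' \<in> C" "a \<otimes> b = a' \<otimes> b'"
        then have carr: "a \<in> carrier G" "a' \<in> carrier G" "b \<in> carrier G" "b' \<in> carrier G"
          using S0 C by auto
        have "a \<otimes> b \<otimes> inv b = a" "a' \<otimes> b' \<otimes> inv b' = a'"
          using carr by (simp_all add: m_assoc)
        then have "a \<otimes> b \<otimes> inv b \<in> S \<union> {\<one>}" "a \<otimes> b \<otimes> inv b' \<in> S \<union> {\<one>}"
          using *(1,2,5) by simp_all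
        then have "b = b'"
          using dom0[OF m_closed[OF carr(1,3)]] *(3,4) by blast
        then show "a = a' \<and> b = b'"
          using * carr by simp
      qed
      have "x \<in> (\<lambda>(a, b). a \<otimes> b) ` ((S \<union> {\<one>}) \<times> C)" if x: "x \<in> carrier G" for x
      proof -
        obtain c where c: "c \<in> C" "x \<otimes> inv c \<in> S \<union> {\<one>}"
          using dom0[OF x] by blast
        moreover have "x = (x \<otimes> inv c) \<otimes> c"
          using x c C by (simp add: m_assoc subset_iff)
        ultimately show ?thesis
          by (intro image_eqI[of _ _ "(x \<otimes> inv c, c)"]) auto
      qed
      then show "(\<lambda>(a, b). a \<otimes> b) ` ((S \<union> {\<one>}) \<times> C) = carrier G"
        using S0 C by (auto simp: subset_iff)
    qed
  next
    assume fact: "factorization (S \<union> {\<one>}) C"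
    then have C: "C \<subseteq> carrier G"
      by (simp add: factorization_def)
    have cancel: "x \<otimes> inv c \<otimes> c = x" if "x \<in> carrier G" "c \<in> C" for x c
      using that C by (simp add: m_assoc subset_iff)
    have uniq: "c = c'"
      if "x \<in> carrier G" "c \<in> C" "c' \<in> C" "x \<otimes> inv c \<in> S \<union> {\<one>}" "x \<otimes> inv c' \<in> S \<union> {\<one>}" for x c c'
      using factorization_inj[OF fact that(4,2,5,3)] cancel that by simp
    \<comment> \<open>Otherwise \<open>y\<close> would be both \<open>\<one> \<otimes> y\<close> and \<open>s \<otimes> x\<close> with \<open>s \<in> S\<close>.\<close>
    have indep: "y \<otimes> inv x \<notin> S" if "x \<in> C" "y \<in> C" for x y
    proof
      assume "y \<otimes> inv x \<in> S"
      moreover have "y \<otimes> inv y = \<one>" using that C by auto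
      ultimately have "x = y"
        using uniq[of y x y] that C by auto
      then show False
        using \<open>y \<otimes> inv x \<in> S\<close> \<open>y \<otimes> inv y = \<one>\<close> S by auto
    qed
    have "\<exists>!c. c \<in> C \<and> c \<otimes> inv x \<in> S" if x: "x \<in> carrier G" "x \<notin> C" for x
    proof -
      obtain s c where sc: "s \<in> S \<union> {\<one>}" "c \<in> C" "s \<otimes> c = x"
        using factorization_surj[OF fact x(1)] by blast
      have carr: "s \<in> carrier G" "c \<in> carrier G"
        using sc S0 C by auto
      have "x \<otimes> inv c = s"
        using sc carr by (auto simp: m_assoc)
      moreover have "s \<noteq> \<one>"
        using sc carr x by auto
      ultimately have "c \<otimes> inv x \<in> S"
        using sc(1) diff_S[OF x(1) carr(2)] by simp
      moreover have "c' = c" if "c' \<in> C" "c' \<otimes> inv x \<in> S" for c'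
        using uniq[OF x(1) that(1) sc(2)] diff_S[OF x(1)] that sc(2) C \<open>c \<otimes> inv x \<in> S\<close> by blast
      ultimately show ?thesis
        using sc by blast
    qed
    then show "perfect_code (cayley_graph G S) C"
      using C indep unfolding perfect_code_def cayley_graph_def
      by (auto simp: subset_iff cong: conj_cong)
  qed
qed


section \<open>Direct products of cyclic groups\<close>

lemma comm_group_cyclic_product: "comm_group (cyclic_product d ns)"
proof -
  interpret group "cyclic_product d ns"
    by (simp add: cyclic_product_def)
  show ?thesis
    by (rule group_comm_groupI) (auto simp: cyclic_product_def add.commute)
qed

lemma carrier_cyclic_product:
  assumes "\<And>i. i \<in> {1..d} \<Longrightarrow> ns i > 0"
  shows "carrier (cyclic_product d ns) = (\<Pi>\<^sub>E i\<in>{1..d}. {0..<int (ns i)})"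
  unfolding cyclic_product_def carrier_product_group
  by (intro PiE_cong) (use assms in \<open>force simp: carrier_integer_mod_group\<close>)

lemma cyclic_product_component_mod:
  assumes pos: "\<And>i. i \<in> {1..d} \<Longrightarrow> ns i > 0" and t: "t \<in> {1..d}" and dvd: "q dvd ns t"
  defines "h \<equiv> \<lambda>x. x t mod int q"
  shows "h \<in> hom (cyclic_product d ns) (integer_mod_group q)"
    "h ` carrier (cyclic_product d ns) = carrier (integer_mod_group q)"
proof -
  have q: "q > 0" "q \<le> ns t"
    using dvd pos[OF t] by (auto intro: dvd_imp_le dvd_pos_nat)
  have carrQ: "carrier (integer_mod_group q) = {0..<int q}"
    using q by (simp add: carrier_integer_mod_group)
  show "h \<in> hom (cyclic_product d ns) (integer_mod_group q)"
  proof (rule homI)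
    show "h x \<in> carrier (integer_mod_group q)" for x
      using q by (simp add: h_def carrQ)
    show "h (x \<otimes>\<^bsub>cyclic_product d ns\<^esub> y) = h x \<otimes>\<^bsub>integer_mod_group q\<^esub> h y" for x y
      using t dvd by (simp add: h_def cyclic_product_def mod_mod_cancel mod_add_eq)
  qed
  have "y \<in> h ` carrier (cyclic_product d ns)" if y: "y \<in> {0..<int q}" for y
  proof (rule image_eqI)
    let ?x = "\<lambda>i\<in>{1..d}. if i = t then y else 0"
    show "y = h ?x"
      using y t by (simp add: h_def)
    show "?x \<in> carrier (cyclic_product d ns)"
      using y q pos by (subst carrier_cyclic_product) (auto simp: PiE_iff)
  qed
  then show "h ` carrier (cyclic_product d ns) = carrier (integer_mod_group q)"
    using q by (auto simp: h_def carrQ)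
qed

theorem theorem4p4:
  fixes d p l t :: nat
    and ns :: "nat \<Rightarrow> nat"
    and G :: "(nat \<Rightarrow> int) monoid"
    and S S0 :: "(nat \<Rightarrow> int) set"
  assumes "\<forall>i\<in>{1..d}. 2 \<le> ns i"
    and "G = cyclic_product d ns"
    and "S \<subseteq> carrier G - {\<one>\<^bsub>G\<^esub>}"
    and "set_inv\<^bsub>G\<^esub> S = S"
    and "generate G S = carrier G"
    and "S0 = S \<union> {\<one>\<^bsub>G\<^esub>}"
    and "prime p" and "1 \<le> l" and "card S0 = p ^ l"
    and "p ^ l dvd (\<Prod>i\<in>{1..d}. ns i)"
    and "\<not> p ^ (l + 1) dvd (\<Prod>i\<in>{1..d}. ns i)"
    and "{i \<in> {1..d}. p dvd ns i} = {t}"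
  shows "(\<exists>C. perfect_code (cayley_graph G S) C) \<longleftrightarrow>
         (\<forall>s\<in>S0. \<forall>s'\<in>S0. s \<noteq> s' \<longrightarrow> \<not> [s t = s' t] (mod int (p ^ l)))"
proof -
  have pos: "ns i > 0" if "i \<in> {1..d}" for i
    using assms(1) that by force
  have t: "t \<in> {1..d}" and t_only: "\<And>i. i \<in> {1..d} - {t} \<Longrightarrow> \<not> p dvd ns i"
    using assms(12) by auto
  interpret comm_group G
    unfolding assms(2) by (rule comm_group_cyclic_product)
  have carrG: "carrier G = (\<Pi>\<^sub>E i\<in>{1..d}. {0..<int (ns i)})"
    unfolding assms(2) by (rule carrier_cyclic_product[OF pos])
  have fin: "finite (carrier G)"
    unfolding carrG by (intro finite_PiE) auto
  have cardG: "card (carrier G) = (\<Prod>i\<in>{1..d}. ns i)"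
    unfolding carrG by (simp add: card_PiE)
  have "coprime (p ^ l) (\<Prod>i\<in>{1..d} - {t}. ns i)"
    using t_only assms(7) by (intro prod_coprime_right) (simp add: prime_imp_coprime coprime_power_left_iff)
  moreover have "p ^ l dvd ns t * (\<Prod>i\<in>{1..d} - {t}. ns i)"
    using assms(10) t by (simp add: prod.remove)
  ultimately have dvd: "p ^ l dvd ns t"
    by (simp add: coprime_dvd_mult_left_iff)
  let ?h = "\<lambda>x. x t mod int (p ^ l)"
  note hom = cyclic_product_component_mod[of d ns t "p ^ l", OF pos t dvd, folded assms(2)]
  have "(\<exists>C. perfect_code (cayley_graph G S) C) \<longleftrightarrow> (\<exists>C. factorization S0 C)"
    using perfect_code_cayley_graph_iff[OF assms(3,4)] by (simp add: assms(6))
  also have "\<dots> \<longleftrightarrow> inj_on ?h S0"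
  proof (rule factorization_iff_inj_on_hom[OF fin _ group_integer_mod_group hom assms(7) _ assms(9)])
    show "S0 \<subseteq> carrier G"
      using assms(3,6) by auto
    show "card (carrier (integer_mod_group (p ^ l))) = p ^ l"
      using prime_gt_0_nat[OF assms(7)]
      by (simp add: carrier_integer_mod_group del: of_nat_power)
    show "\<not> p ^ (l + 1) dvd card (carrier G)"
      unfolding cardG by (rule assms(11))
  qed
  also have "\<dots> \<longleftrightarrow> (\<forall>s\<in>S0. \<forall>s'\<in>S0. s \<noteq> s' \<longrightarrow> \<not> [s t = s' t] (mod int (p ^ l)))"
    by (auto simp: inj_on_def cong_def)
  finally show ?thesis .
qed

end
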